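(* Let $\mathbb F\in\{\mathbb R,\mathbb C\}$, let $\mathcal H\subseteq\mathbb F^M$ be an $m$-dimensional subspace, and let $\Phi=\{\boldsymbol\varphi_1,\dots,\boldsymbol\varphi_N\}\subset\mathcal H$, $N\ge2$, be a unit-norm tight frame for $\mathcal H$ (so that $\Phi$ spans $\mathcal H$) with $\gamma_\Phi>0$. Then $$N\le\begin{cases}m(m+1)/2&\text{for }\mathbb F=\mathbb R,\\ m^2&\text{for }\mathbb F=\mathbb C,\end{cases}$$ and $$\gamma_\Phi\le\frac{N(m-1)}{m(N-1)}.$$ Equality holds in the latter inequality if and only if $\Phi$ is an equiangular tight frame (ETF).
   Context: A family $\Phi=\{\boldsymbol\varphi_1,\dots,\boldsymbol\varphi_N\}\subset\mathcal H$ is a unit-norm tight frame (UNTF) for the $m$-dimensional space $\mathcal H$ if $\|\boldsymbol\varphi_i\|_2=1$ for all $i$ and $\sum_{i=1}^N|\langle\boldsymbol a,\boldsymbol\varphi_i\rangle|^2=\frac Nm\|\boldsymbol a\|_2^2$ for all $\boldsymbol a\in\mathcal H$. It is an equiangular tight frame (ETF) if moreover $|\langle\boldsymbol\varphi_i,\boldsymbol\varphi_j\rangle|$ is the same constant for all $i\ne j$. Define on $\mathcal H$ the operators $P_i\boldsymbol a=\langle\boldsymbol a,\boldsymbol\varphi_i\rangle\boldsymbol\varphi_i$ and $Q_i=P_i-\frac1m\mathrm{Id}_{\mathcal H}$, and the real symmetric Gram matrix $\boldsymbol G_\Phi=[\operatorname{trace}(Q_iQ_j)]_{i,j=1}^N\in\mathbb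 R^{N\times N}$. It satisfies $\boldsymbol G_\Phi\boldsymbol 1_N=\boldsymbol 0$, where $\boldsymbol 1_N$ is the all-ones vector. Define $\gamma_\Phi=\lambda_{\min}(\boldsymbol G_\Phi|_{\boldsymbol 1_N^\perp})$, the smallest eigenvalue of $\boldsymbol G_\Phi$ on the orthogonal complement of $\boldsymbol 1_N$. *)

theory Defs
  imports "HOL-Analysis.Analysis" "Jordan_Normal_Form.Conjugate"
begin

text \<open>The class captures what is common to the scalar fields of real and of complex numbers;
  it only serves to give the definitions below once for both. The theorem itself is about the
  two instances.\<close>

class rc_scalar = real_normed_field + conjugatable_field +
  fixes re_part :: "'a \<Rightarrow> real"
  assumes mult_conjugate_scaleR: "x * conjugate x = (norm x)\<^sup>2 *\<^sub>R 1"
    and add_conjugate_scaleR: "x + conjugate x = (2 * re_part x) *\<^sub>R 1"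

lemma mult_conjugate: "x * conjugate x = of_real ((norm (x :: 'f::rc_scalar))\<^sup>2)"
  by (simp only: of_real_def mult_conjugate_scaleR)

instantiation real :: rc_scalar
begin
definition re_part_real: "re_part (x :: real) = x"
instance by intro_classes (simp_all add: re_part_real power2_eq_square)
end

instantiation complex :: rc_scalar
begin
definition re_part_complex: "re_part (z :: complex) = Re z"
instance
  by intro_classes
    (auto simp: re_part_complex scaleR_conv_of_real complex_mult_cnj cmod_power2 complex_add_cnj)
end

definition herm_inner :: "'f::rc_scalar ^ 'd \<Rightarrow> 'f ^ 'd \<Rightarrow> 'f" where
  "herm_inner a b = (\<Sum>k\<in>UNIV. a $ k * conjugate (b $ k))"

text \<open>Trace of a linear operator on the subspace \<open>H\<close>: the sum of the diagonal entries of its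
  matrix with respect to a basis of \<open>H\<close>. The value does not depend on the basis that is
  chosen, see \<open>trace_on_eq\<close> below.\<close>

definition is_basis_of :: "('f::field ^ 'd) set \<Rightarrow> ('f ^ 'd) set \<Rightarrow> bool" where
  "is_basis_of H B \<longleftrightarrow> B \<subseteq> H \<and> vec.independent B \<and> H \<subseteq> vec.span B"

definition trace_on :: "('f::field ^ 'd) set \<Rightarrow> ('f ^ 'd \<Rightarrow> 'f ^ 'd) \<Rightarrow> 'f" where
  "trace_on H T =
     (let B = (SOME B. is_basis_of H B) in \<Sum>b\<in>B. vec.representation B (T b) b)"

text \<open>Families are indexed by a finite type, so repetitions are allowed.\<close>

definition unit_norm_tight_frame ::
    "('f::rc_scalar ^ 'd) set \<Rightarrow> ('n::finite \<Rightarrow> 'f ^ 'd) \<Rightarrow> bool" where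
  "unit_norm_tight_frame H \<phi> \<longleftrightarrow>
     (\<forall>i. \<phi> i \<in> H) \<and> (\<forall>i. norm (\<phi> i) = 1) \<and>
     (\<forall>a\<in>H. (\<Sum>i\<in>UNIV. (norm (herm_inner a (\<phi> i)))\<^sup>2)
            = real CARD('n) / real (vec.dim H) * (norm a)\<^sup>2)"

definition equiangular_tight_frame ::
    "('f::rc_scalar ^ 'd) set \<Rightarrow> ('n::finite \<Rightarrow> 'f ^ 'd) \<Rightarrow> bool" where
  "equiangular_tight_frame H \<phi> \<longleftrightarrow>
     unit_norm_tight_frame H \<phi> \<and>
     (\<exists>c. \<forall>i j. i \<noteq> j \<longrightarrow> norm (herm_inner (\<phi> i) (\<phi> j)) = c)"

definition frame_P :: "('n \<Rightarrow> 'f::rc_scalar ^ 'd) \<Rightarrow> 'n \<Rightarrow> 'f ^ 'd \<Rightarrow> 'f ^ 'd" where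
  "frame_P \<phi> i a = herm_inner a (\<phi> i) *s \<phi> i"

definition frame_Q ::
    "('f::rc_scalar ^ 'd) set \<Rightarrow> ('n \<Rightarrow> 'f ^ 'd) \<Rightarrow> 'n \<Rightarrow> 'f ^ 'd \<Rightarrow> 'f ^ 'd" where
  "frame_Q H \<phi> i a = frame_P \<phi> i a - (1 / of_nat (vec.dim H)) *s a"

text \<open>The traces are scalars of the ground field with real values (\<open>trace_frame_Q\<close> below);
  \<open>re_part\<close> only changes their type.\<close>

definition frame_gram ::
    "('f::rc_scalar ^ 'd) set \<Rightarrow> ('n::finite \<Rightarrow> 'f ^ 'd) \<Rightarrow> real ^ 'n ^ 'n" where
  "frame_gram H \<phi> = (\<chi> i j. re_part (trace_on H (frame_Q H \<phi> i \<circ> frame_Q H \<phi> j)))"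

definition eigenvalues_on :: "(real ^ 'n) set \<Rightarrow> real ^ 'n ^ 'n \<Rightarrow> real set" where
  "eigenvalues_on W A = {\<mu>. \<exists>v\<in>W. v \<noteq> 0 \<and> A *v v = \<mu> *s v}"

text \<open>Here \<open>1\<close> is the all-ones vector.\<close>

definition frame_gamma ::
    "('f::rc_scalar ^ 'd) set \<Rightarrow> ('n::finite \<Rightarrow> 'f ^ 'd) \<Rightarrow> real" where
  "frame_gamma H \<phi> = Min (eigenvalues_on ({1}\<^sup>\<bottom>) (frame_gram H \<phi>))"


lemma basis_finite: "is_basis_of H B \<Longrightarrow> finite B"
  by (simp add: is_basis_of_def vec.finiteI_independent)

lemma basis_expand:
  assumes "is_basis_of H B" "v \<in> H"
  shows "(\<Sum>b\<in>B. vec.representation B v b *s b) = v"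
  using assms basis_finite[OF assms(1)]
  by (intro vec.sum_representation_eq) (auto simp: is_basis_of_def)

lemma trace_on_eq:
  fixes H :: "('f::field ^ 'd) set"
  assumes H: "vec.subspace H" and B: "is_basis_of H B"
    and T: "Vector_Spaces.linear (*s) (*s) T" "T ` H \<subseteq> H"
  shows "trace_on H T = (\<Sum>b\<in>B. vec.representation B (T b) b)"
proof -
  define C where "C = (SOME C. is_basis_of H C)"
  have C: "is_basis_of H C"
    unfolding C_def by (rule someI[of _ B]) (rule B)
  note fin = basis_finite[OF B] basis_finite[OF C]
  interpret T: Vector_Spaces.linear "(*s)" "(*s)" T by (rule T(1))
  have iB: "vec.independent B" and iC: "vec.independent C"
    using B C by (auto simp: is_basis_of_def)
  have sp: "v \<in> vec.span B" "v \<in> vec.span C" if "v \<in> H" for v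
    using B C that by (auto simp: is_basis_of_def)
  have BH: "b \<in> H" if "b \<in> B" for b using B that by (auto simp: is_basis_of_def)
  have CH: "c \<in> H" if "c \<in> C" for c using C that by (auto simp: is_basis_of_def)
  have TH: "T v \<in> H" if "v \<in> H" for v using T(2) that by auto
  have exp: "vec.representation B (T b) b =
      (\<Sum>c\<in>C. vec.representation C (T b) c * vec.representation B c b)"
    if b: "b \<in> B" for b
  proof -
    have "vec.representation B (T b) =
        vec.representation B (\<Sum>c\<in>C. vec.representation C (T b) c *s c)"
      using basis_expand[OF C TH[OF BH[OF b]]] by simp
    also have "\<dots> = (\<lambda>x. \<Sum>c\<in>C. vec.representation B (vec.representation C (T b) c *s c) x)"
      using sp CH by (intro vec.representation_sum[OF iB]) (auto intro: vec.span_scale)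
    also have "\<dots> = (\<lambda>x. \<Sum>c\<in>C. vec.representation C (T b) c * vec.representation B c x)"
      using sp CH by (intro ext sum.cong) (auto simp: vec.representation_scale[OF iB])
    finally show ?thesis by simp
  qed
  have exp2: "vec.representation C (T c) c =
      (\<Sum>b\<in>B. vec.representation B c b * vec.representation C (T b) c)"
    if c: "c \<in> C" for c
  proof -
    have "T c = T (\<Sum>b\<in>B. vec.representation B c b *s b)"
      using basis_expand[OF B CH[OF c]] by simp
    also have "\<dots> = (\<Sum>b\<in>B. vec.representation B c b *s T b)"
      by (simp add: T.sum T.scale)
    finally have "vec.representation C (T c) =
        vec.representation C (\<Sum>b\<in>B. vec.representation B c b *s T b)" by simp
    also have "\<dots> = (\<lambda>x. \<Sum>b\<in>B. vec.representation C (vec.representation B c b *s T b) x)"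
      using sp BH TH by (intro vec.representation_sum[OF iC]) (auto intro: vec.span_scale)
    also have "\<dots> = (\<lambda>x. \<Sum>b\<in>B. vec.representation B c b * vec.representation C (T b) x)"
      using sp BH TH by (intro ext sum.cong) (auto simp: vec.representation_scale[OF iC])
    finally show ?thesis by simp
  qed
  have "trace_on H T = (\<Sum>c\<in>C. vec.representation C (T c) c)"
    by (simp add: trace_on_def C_def Let_def)
  also have "\<dots> = (\<Sum>c\<in>C. \<Sum>b\<in>B. vec.representation B c b * vec.representation C (T b) c)"
    by (simp add: exp2)
  also have "\<dots> = (\<Sum>b\<in>B. \<Sum>c\<in>C. vec.representation C (T b) c * vec.representation B c b)"
    by (subst sum.swap) (simp add: mult.commute)
  also have "\<dots> = (\<Sum>b\<in>B. vec.representation B (T b) b)"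
    by (simp add: exp)
  finally show ?thesis .
qed

lemma herm_inner_conjugate:
  "conjugate (herm_inner a b) = herm_inner b (a :: 'f::rc_scalar ^ 'd)"
  by (simp add: herm_inner_def sum_conjugate conjugate_dist_mul mult.commute)

lemma herm_inner_self: "herm_inner a a = of_real ((norm (a :: 'f::rc_scalar ^ 'd))\<^sup>2)"
  by (simp add: herm_inner_def mult_conjugate norm_vec_def L2_set_def sum_nonneg)

lemma trace_frame_Q:
  fixes H :: "('f::rc_scalar ^ 'd) set" and \<phi> :: "'n::finite \<Rightarrow> 'f ^ 'd"
  assumes H: "vec.subspace H" and \<phi>: "unit_norm_tight_frame H \<phi>"
  shows "trace_on H (frame_Q H \<phi> i \<circ> frame_Q H \<phi> j) =
    of_real ((norm (herm_inner (\<phi> i) (\<phi> j)))\<^sup>2 - 1 / real (vec.dim H))"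
proof -
  define m where "m = (of_nat (vec.dim H) :: 'f)"
  have \<phi>H: "\<phi> i \<in> H" and unit: "norm (\<phi> i) = 1" for i
    using \<phi> by (auto simp: unit_norm_tight_frame_def)
  define B where "B = (SOME B. is_basis_of H B)"
  obtain B0 where "B0 \<subseteq> H" "vec.independent B0" "H \<subseteq> vec.span B0" "card B0 = vec.dim H"
    by (rule vec.basis_exists)
  then have B: "is_basis_of H B"
    unfolding B_def by (intro someI_ex[of "is_basis_of H"]) (auto simp: is_basis_of_def)
  have iB: "vec.independent B" and BH: "B \<subseteq> H" using B by (auto simp: is_basis_of_def)
  have HB: "v \<in> vec.span B" if "v \<in> H" for v using B that by (auto simp: is_basis_of_def)
  have card: "card B = vec.dim H"
    by (rule vec.basis_card_eq_dim) (use B in \<open>auto simp: is_basis_of_def\<close>)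
  have "\<phi> i \<noteq> 0" using unit[of i] by auto
  then have "B \<noteq> {}" using basis_expand[OF B \<phi>H[of i]] by auto
  then have m0: "vec.dim H \<noteq> 0" using card basis_finite[OF B] by (metis card_0_eq)
  then have m: "m \<noteq> 0" by (simp add: m_def del: vec.dim_eq_0)
  define r where "r = vec.representation B"
  have r_scale: "r (c *s v) b = c * r v b" if "v \<in> H" for c v b
    using HB[OF that] by (simp add: r_def vec.representation_scale[OF iB])
  have r_diff: "r (u - v) b = r u b - r v b" if "u \<in> H" "v \<in> H" for u v b
    using that by (simp add: r_def vec.representation_diff[OF iB] HB)
  have rb: "r b b = 1" if "b \<in> B" for b
    using that by (simp add: r_def vec.representation_basis[OF iB])
  have r_inner: "(\<Sum>b\<in>B. herm_inner b w * r v b) = herm_inner v w" if "v \<in> H" for v w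
  proof -
    have "herm_inner v w = herm_inner (\<Sum>b\<in>B. r v b *s b) w"
      using basis_expand[OF B that] by (simp add: r_def)
    also have "\<dots> = (\<Sum>b\<in>B. herm_inner b w * r v b)"
      unfolding herm_inner_def sum_distrib_left sum_distrib_right
      by (subst sum.swap) (simp add: sum_distrib_left sum_distrib_right mult_ac)
    finally show ?thesis by simp
  qed
  have diffH: "u - v \<in> H" if "u \<in> H" "v \<in> H" for u v
    using that H by (rule vec.subspace_diff[rotated 1])
  have scH: "c *s v \<in> H" if "v \<in> H" for c v using that H by (simp add: vec.subspace_scale)
  define g where "g = herm_inner (\<phi> j) (\<phi> i)"
  have "r ((frame_Q H \<phi> i \<circ> frame_Q H \<phi> j) b) b =
      g * (herm_inner b (\<phi> j) * r (\<phi> i) b) - 1/m * (herm_inner b (\<phi> i) * r (\<phi> i) b)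
      - 1/m * (herm_inner b (\<phi> j) * r (\<phi> j) b) + 1/m * (1/m)" if b: "b \<in> B" for b
  proof -
    have bH: "b \<in> H" using b BH by auto
    have "herm_inner (herm_inner b (\<phi> j) *s \<phi> j - (1/m) *s b) (\<phi> i)
        = herm_inner b (\<phi> j) * g - 1/m * herm_inner b (\<phi> i)"
      unfolding g_def herm_inner_def
      by (simp add: algebra_simps sum_subtractf sum_distrib_left)
    then show ?thesis
      by (simp add: frame_Q_def frame_P_def m_def[symmetric] r_diff r_scale diffH scH \<phi>H bH
          rb b left_diff_distrib right_diff_distrib mult_ac)
  qed
  then have "trace_on H (frame_Q H \<phi> i \<circ> frame_Q H \<phi> j) =
      (\<Sum>b\<in>B. g * (herm_inner b (\<phi> j) * r (\<phi> i) b) - 1/m * (herm_inner b (\<phi> i) * r (\<phi> i) b)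
      - 1/m * (herm_inner b (\<phi> j) * r (\<phi> j) b) + 1/m * (1/m))"
    unfolding trace_on_def B_def[symmetric] Let_def r_def[symmetric] by (rule sum.cong[OF refl])
  also have "\<dots> = g * herm_inner (\<phi> i) (\<phi> j) - 1/m * 1 - 1/m * 1 + 1/m * (m * (1/m))"
    by (simp only: sum.distrib sum_subtractf sum_distrib_left[symmetric] r_inner[OF \<phi>H]
        herm_inner_self unit sum_constant card m_def[symmetric] power_one of_real_1)
  also have "\<dots> = g * conjugate g - 1/m"
    using m by (simp add: g_def herm_inner_conjugate field_simps)
  also have "\<dots> = of_real ((norm g)\<^sup>2 - 1 / real (vec.dim H))"
    by (simp add: mult_conjugate m_def)
  also have "norm g = norm (herm_inner (\<phi> i) (\<phi> j))"
  proof -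
    have "of_real ((norm g)\<^sup>2) = (of_real ((norm (conjugate g))\<^sup>2) :: 'f)"
      by (metis mult_conjugate conjugate_id mult.commute)
    then have "(norm g)\<^sup>2 = (norm (conjugate g))\<^sup>2" by (simp only: of_real_eq_iff)
    then show ?thesis by (simp add: g_def herm_inner_conjugate)
  qed
  finally show ?thesis .
qed

end

theory Submission
  imports Defs
begin

text \<open>
  Write \<open>K\<close> for the matrix of the numbers \<open>\<bar>\<langle>\<phi>\<^sub>i, \<phi>\<^sub>j\<rangle>\<bar>\<^sup>2\<close>. The frame matrix \<open>G\<close> has entries
  \<open>K\<^sub>i\<^sub>j - 1/m\<close>, its diagonal is constantly \<open>1 - 1/m\<close>, and tightness says that its rows sum to 0. By the
  variational principle (\<open>Min_eigenvalues_on_le\<close>), \<open>v \<bullet> G v \<ge> \<gamma> (v \<bullet> v)\<close> for all \<open>v\<close>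
  orthogonal to the all-ones vector \<open>1\<close>, and equality forces \<open>G v = \<gamma> v\<close>.

  The bound on \<open>\<gamma>\<close> comes from the test vectors \<open>e\<^sub>i - 1/N\<close>, the projections of the unit vectors:
  since \<open>G 1 = 0\<close>, the inequality reads \<open>1 - 1/m = G\<^sub>i\<^sub>i \<ge> \<gamma> (1 - 1/N)\<close>. If equality holds, every test
  vector is an eigenvector, so \<open>G = \<gamma> (Id - J/N)\<close> with the all-ones matrix \<open>J\<close>; the off-diagonal
  entries of \<open>G\<close>, hence those of \<open>K\<close>, are then all equal. Conversely, constant off-diagonal
  entries make \<open>G\<close> a multiple of \<open>Id - J/N\<close>, whose only eigenvalue on the complement of \<open>1\<close> is
  read off from the diagonal.

  For the bound on \<open>N\<close>, the point is that the projections onto the lines of the \<open>\<phi>\<^sub>i\<close> are linearly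
  independent over the reals (\<open>frame_projections_independent\<close>): a relation with coefficients \<open>c\<close>
  gives \<open>K c = 0\<close>; summing the entries gives \<open>1 \<bullet> c = 0\<close>, hence \<open>G c = 0\<close>, and \<open>\<gamma> > 0\<close> yields
  \<open>c = 0\<close>. These projections lie in the real space of self-adjoint operators, of dimension
  \<open>m (m + 1) / 2\<close> or \<open>m\<^sup>2\<close>. The latter is expressed in coordinates: the projections are determined by
  the products \<open>x\<^sub>p conj(x\<^sub>q)\<close>, \<open>p \<le> q\<close>, of the coordinates of the \<open>\<phi>\<^sub>i\<close> with respect to any basis.
\<close>

section \<open>Smallest eigenvalues of symmetric matrices on invariant subspaces\<close>

lemma symmetric_matrix_inner:
  fixes A :: "real ^ 'n ^ 'n"
  assumes "\<And>i j. A $ i $ j = A $ j $ i"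
  shows "u \<bullet> (A *v v) = (A *v u) \<bullet> v"
proof -
  have "transpose A = A" using assms by (simp add: transpose_def vec_eq_iff)
  then have "u v* A = A *v u" by (metis transpose_matrix_vector)
  then show ?thesis by (metis dot_lmul_matrix)
qed

text \<open>A vector at which a positive semidefinite form vanishes lies in the kernel of the operator
  that represents the form.\<close>

lemma psd_form_zero_imp_kernel:
  fixes f :: "'a::real_inner \<Rightarrow> 'a"
  assumes f: "linear f" and W: "subspace W" "\<And>v. v \<in> W \<Longrightarrow> f v \<in> W"
    and sym: "\<And>u v. u \<bullet> f v = f u \<bullet> v"
    and psd: "\<And>v. v \<in> W \<Longrightarrow> 0 \<le> v \<bullet> f v"
    and v: "v \<in> W" "v \<bullet> f v = 0"
  shows "f v = 0"
proof (rule ccontr)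
  assume "f v \<noteq> 0"
  define w where "w = f v"
  define a b where "a = w \<bullet> w" and "b = w \<bullet> f w"
  have w: "w \<in> W" using W v by (simp add: w_def)
  have a: "a > 0" using \<open>f v \<noteq> 0\<close> by (simp add: a_def w_def)
  have b: "b \<ge> 0" using psd[OF w] by (simp add: b_def)
  \<comment> \<open>Moving from \<open>v\<close> a short way in the direction \<open>- f v\<close> would make the form negative.\<close>
  define t where "t = a / (b + 1)"
  have "v \<bullet> f w = a" using sym[of v w] by (simp add: a_def w_def)
  moreover have "v - t *\<^sub>R w \<in> W" using W v w by (simp add: subspace_diff subspace_scale)
  ultimately have "0 \<le> - 2 * t * a + t * t * b"
    using psd[of "v - t *\<^sub>R w"] v
    by (simp add: linear_diff[OF f] linear_scale[OF f] inner_diff_left inner_diff_right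
        w_def[symmetric] a_def[symmetric] b_def[symmetric] algebra_simps)
  moreover have "t * (b + 1) = a" using b by (simp add: t_def)
  then have "- 2 * t * a + t * t * b = - t * a - t * t" by (auto simp: algebra_simps)
  moreover have "t * a > 0" using a b by (simp add: t_def)
  ultimately show False using zero_le_square[of t] by linarith
qed

text \<open>Eigenvectors for distinct eigenvalues are orthogonal, so there are only finitely many
  eigenvalues and their minimum is meaningful.\<close>

lemma finite_eigenvalues_on:
  fixes A :: "real ^ 'n ^ 'n"
  assumes "\<And>i j. A $ i $ j = A $ j $ i"
  shows "finite (eigenvalues_on W A)"
proof -
  have "\<forall>\<mu>\<in>eigenvalues_on W A. \<exists>v. v \<noteq> 0 \<and> A *v v = \<mu> *s v"
    by (auto simp: eigenvalues_on_def)
  then obtain e where e: "e \<mu> \<noteq> 0" "A *v e \<mu> = \<mu> *s e \<mu>" if "\<mu> \<in> eigenvalues_on W A" for \<mu>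
    by metis
  have orth: "orthogonal (e \<mu>) (e \<nu>)"
    if "\<mu> \<in> eigenvalues_on W A" "\<nu> \<in> eigenvalues_on W A" "\<mu> \<noteq> \<nu>" for \<mu> \<nu>
    using symmetric_matrix_inner[OF assms, of "e \<mu>" "e \<nu>"] e[OF that(1)] e[OF that(2)] that(3)
    by (simp add: orthogonal_def scalar_mult_eq_scaleR)
  have "pairwise orthogonal (e ` eigenvalues_on W A)"
    using orth by (auto simp: pairwise_def)
  then have "finite (e ` eigenvalues_on W A)" by (rule pairwise_orthogonal_imp_finite)
  moreover have "inj_on e (eigenvalues_on W A)"
    using orth e by (metis inj_onI orthogonal_self)
  ultimately show ?thesis by (rule finite_imageD)
qed

text \<open>The smallest eigenvalue is the minimum of the Rayleigh quotient. The minimum is attained on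
  the compact unit sphere of the subspace, and every minimizer is an eigenvector because the form
  shifted by the minimum is positive semidefinite and vanishes there.\<close>

lemma
  fixes A :: "real ^ 'n ^ 'n"
  assumes sym: "\<And>i j. A $ i $ j = A $ j $ i"
    and W: "subspace W" "\<And>v. v \<in> W \<Longrightarrow> A *v v \<in> W" and ne: "w \<in> W" "w \<noteq> 0"
  shows Min_eigenvalues_on_le: "\<And>v. v \<in> W \<Longrightarrow> Min (eigenvalues_on W A) * (v \<bullet> v) \<le> v \<bullet> (A *v v)"
    and Min_eigenvalues_on_eq: "\<And>v. \<lbrakk>v \<in> W; v \<bullet> (A *v v) = Min (eigenvalues_on W A) * (v \<bullet> v)\<rbrakk>
       \<Longrightarrow> A *v v = Min (eigenvalues_on W A) *s v"
proof -
  have "compact (W \<inter> sphere 0 1)"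
    using W(1) by (simp add: closed_subspace closed_Int_compact)
  moreover have "inverse (norm w) *\<^sub>R w \<in> W \<inter> sphere 0 1"
    using ne W(1) by (simp add: subspace_scale)
  then have "W \<inter> sphere 0 1 \<noteq> {}" by blast
  moreover have "continuous_on (W \<inter> sphere 0 1) (\<lambda>v. v \<bullet> (A *v v))"
    by (intro continuous_intros linear_continuous_on) (simp add: linear_linear[symmetric])
  ultimately obtain v0 where "v0 \<in> W \<inter> sphere 0 1"
    and "\<forall>v\<in>W \<inter> sphere 0 1. v0 \<bullet> (A *v v0) \<le> v \<bullet> (A *v v)"
    using continuous_attains_inf[of "W \<inter> sphere 0 1" "\<lambda>v. v \<bullet> (A *v v)"] by blast
  then have v0: "v0 \<in> W" "norm v0 = 1"
    and min: "\<And>v. v \<in> W \<Longrightarrow> norm v = 1 \<Longrightarrow> v0 \<bullet> (A *v v0) \<le> v \<bullet> (A *v v)"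
    by simp_all
  define \<mu> where "\<mu> = v0 \<bullet> (A *v v0)"
  have le: "\<mu> * (v \<bullet> v) \<le> v \<bullet> (A *v v)" if "v \<in> W" for v
  proof (cases "v = 0")
    case False
    have "\<mu> \<le> (inverse (norm v) *\<^sub>R v) \<bullet> (A *v (inverse (norm v) *\<^sub>R v))"
      unfolding \<mu>_def using that False W(1) by (intro min) (simp_all add: subspace_scale)
    also have "\<dots> = v \<bullet> (A *v v) / (norm v)\<^sup>2"
      by (simp add: matrix_vector_mult_scaleR power2_eq_square field_simps)
    finally show ?thesis using False by (simp add: field_simps dot_square_norm)
  qed simp
  define f where "f = (\<lambda>v. A *v v - \<mu> *\<^sub>R v)"
  have ker: "A *v v = \<mu> *s v" if "v \<in> W" "v \<bullet> (A *v v) = \<mu> * (v \<bullet> v)" for v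
  proof -
    have "f v = 0"
    proof (rule psd_form_zero_imp_kernel[where f = f and W = W])
      show "linear f"
        by (rule linearI) (simp_all add: f_def algebra_simps matrix_vector_right_distrib
            matrix_vector_mult_scaleR)
      show "u \<bullet> f v = f u \<bullet> v" for u v
        by (simp add: f_def inner_diff_left inner_diff_right symmetric_matrix_inner[OF sym])
    qed (use that W le in \<open>auto simp: f_def inner_diff_right subspace_diff subspace_scale\<close>)
    then show ?thesis by (simp add: f_def scalar_mult_eq_scaleR)
  qed
  have "A *v v0 = \<mu> *s v0"
    by (rule ker) (use v0 in \<open>simp_all add: \<mu>_def dot_square_norm\<close>)
  moreover have "v0 \<noteq> 0" using v0 by auto
  ultimately have "\<mu> \<in> eigenvalues_on W A" using v0 by (auto simp: eigenvalues_on_def)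
  moreover have "\<mu> \<le> \<nu>" if \<nu>: "\<nu> \<in> eigenvalues_on W A" for \<nu>
  proof -
    obtain v where v: "v \<in> W" "v \<noteq> 0" "A *v v = \<nu> *s v"
      using \<nu> by (auto simp: eigenvalues_on_def)
    then show ?thesis using le[of v] by (simp add: scalar_mult_eq_scaleR)
  qed
  ultimately have Min: "Min (eigenvalues_on W A) = \<mu>"
    by (intro Min_eqI finite_eigenvalues_on[OF sym]) auto
  show "Min (eigenvalues_on W A) * (v \<bullet> v) \<le> v \<bullet> (A *v v)" if "v \<in> W" for v
    using le that by (simp add: Min)
  show "A *v v = Min (eigenvalues_on W A) *s v"
    if "v \<in> W" "v \<bullet> (A *v v) = Min (eigenvalues_on W A) * (v \<bullet> v)" for v
    using ker that by (simp add: Min)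
qed

section \<open>Symmetric matrices with vanishing row sums\<close>

lemma mem_ones_comp: "v \<in> {1 :: real ^ 'n}\<^sup>\<bottom> \<longleftrightarrow> (\<Sum>i\<in>UNIV. v $ i) = 0"
  by (simp add: orthogonal_comp_def orthogonal_def inner_vec_def)

lemma matrix_vector_mult_mem_ones_comp:
  fixes A :: "real ^ 'n ^ 'n"
  assumes sym: "\<And>i j. A $ i $ j = A $ j $ i" and row: "\<And>i. (\<Sum>j\<in>UNIV. A $ i $ j) = 0"
  shows "A *v v \<in> {1}\<^sup>\<bottom>"
proof -
  have "A *v 1 = 0" using row by (simp add: matrix_vector_mult_def vec_eq_iff)
  then have "1 \<bullet> (A *v v) = 0" using symmetric_matrix_inner[OF sym, of 1 v] by simp
  then show ?thesis by (simp add: orthogonal_comp_def orthogonal_def)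
qed

text \<open>The orthogonal projection of a standard unit vector to the complement of the all-ones
  vector.\<close>

definition centred_axis :: "'n::finite \<Rightarrow> real ^ 'n" where
  "centred_axis i = axis i 1 - (1 / real CARD('n)) *\<^sub>R 1"

lemma centred_axis_nth:
  "centred_axis i $ j = (if j = i then 1 else 0) - 1 / real CARD('n)" for i :: "'n::finite"
  by (simp add: centred_axis_def axis_def)

lemma centred_axis_mem: "centred_axis i \<in> {1}\<^sup>\<bottom>"
  by (simp add: mem_ones_comp centred_axis_nth sum_subtractf)

lemma inner_centred_axis:
  "v \<in> {1}\<^sup>\<bottom> \<Longrightarrow> centred_axis i \<bullet> v = v $ i"
  by (simp add: centred_axis_def inner_diff_left inner_axis' orthogonal_comp_def orthogonal_def)

lemma inner_centred_axis_self:
  "centred_axis i \<bullet> centred_axis i = 1 - 1 / real CARD('n)" for i :: "'n::finite"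
  by (simp add: inner_centred_axis[OF centred_axis_mem] centred_axis_nth)

lemma matrix_mult_centred_axis:
  fixes A :: "real ^ 'n ^ 'n"
  assumes "\<And>i. (\<Sum>j\<in>UNIV. A $ i $ j) = 0"
  shows "(A *v centred_axis i) $ j = A $ j $ i"
proof -
  have "A *v 1 = 0" using assms by (simp add: matrix_vector_mult_def vec_eq_iff)
  then show ?thesis
    by (simp add: centred_axis_def matrix_vector_mult_diff_distrib matrix_vector_mult_scaleR
        matrix_vector_mult_basis column_def)
qed

lemma
  fixes A :: "real ^ 'n ^ 'n"
  assumes sym: "\<And>i j. A $ i $ j = A $ j $ i" and row: "\<And>i. (\<Sum>j\<in>UNIV. A $ i $ j) = 0"
    and N: "CARD('n) \<ge> 2"
  defines "\<gamma> \<equiv> Min (eigenvalues_on ({1}\<^sup>\<bottom>) A)"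
  shows Min_eigenvalues_on_le_diag: "\<gamma> * (1 - 1 / real CARD('n)) \<le> A $ i $ i"
    and Min_eigenvalues_on_eq_diag_iff:
      "(\<forall>i. A $ i $ i = \<gamma> * (1 - 1 / real CARD('n)))
        \<longleftrightarrow> (\<exists>k. \<forall>i j. i \<noteq> j \<longrightarrow> A $ i $ j = k)" (is "?eq \<longleftrightarrow> ?off")
    and Min_eigenvalues_on_kernel: "\<gamma> > 0 \<Longrightarrow> v \<in> {1}\<^sup>\<bottom> \<Longrightarrow> A *v v = 0 \<Longrightarrow> v = 0"
proof -
  let ?W = "{1}\<^sup>\<bottom> :: (real ^ 'n) set"
  let ?N = "real CARD('n)"
  have W: "subspace ?W" by (rule subspace_orthogonal_comp)
  note AW = matrix_vector_mult_mem_ones_comp[OF sym row]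
  have ne: "centred_axis (undefined :: 'n) \<noteq> 0"
  proof
    assume "centred_axis (undefined :: 'n) = 0"
    then have "1 - 1 / ?N = 0" using inner_centred_axis_self[of "undefined :: 'n"] by simp
    then show False using N by simp
  qed
  note le = Min_eigenvalues_on_le[OF sym W AW centred_axis_mem ne, folded \<gamma>_def]
  note eq = Min_eigenvalues_on_eq[OF sym W AW centred_axis_mem ne, folded \<gamma>_def]
  have form: "centred_axis i \<bullet> (A *v centred_axis i) = A $ i $ i" for i
    by (simp add: inner_centred_axis AW matrix_mult_centred_axis row)
  show "\<gamma> * (1 - 1 / ?N) \<le> A $ i $ i"
    using le[OF centred_axis_mem, of i] by (simp add: form inner_centred_axis_self)
  show "v = 0" if "\<gamma> > 0" "v \<in> ?W" "A *v v = 0"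
  proof -
    have "\<gamma> * (v \<bullet> v) \<le> 0" using le[OF that(2)] that(3) by simp
    then have "v \<bullet> v \<le> 0" using that(1) by (simp add: mult_le_0_iff)
    then show ?thesis by (simp add: dot_square_norm)
  qed
  show "?eq \<longleftrightarrow> ?off"
  proof
    assume d: ?eq
    have "A $ j $ i = - \<gamma> / ?N" if "j \<noteq> i" for i j
    proof -
      have "A *v centred_axis i = \<gamma> *s centred_axis i"
        using d by (intro eq centred_axis_mem) (simp add: form inner_centred_axis_self)
      then have "A $ j $ i = (\<gamma> *s centred_axis i) $ j"
        by (metis matrix_mult_centred_axis row)
      then show ?thesis using that by (simp add: centred_axis_nth)
    qed
    then show ?off by blast
  next
    assume ?off
    then obtain k where k: "\<And>i j. i \<noteq> j \<Longrightarrow> A $ i $ j = k" by blast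
    have diag: "A $ i $ i = - (?N - 1) * k" for i
    proof -
      have "(\<Sum>j\<in>UNIV. A $ i $ j) = A $ i $ i + (\<Sum>j\<in>UNIV - {i}. A $ i $ j)"
        by (simp add: sum.remove)
      also have "(\<Sum>j\<in>UNIV - {i}. A $ i $ j) = (\<Sum>j\<in>UNIV - {i}. k)"
        by (intro sum.cong refl k) auto
      also have "\<dots> = (?N - 1) * k"
        using N by (simp add: card_Diff_singleton of_nat_diff)
      finally have "A $ i $ i + (?N - 1) * k = 0" by (simp only: row)
      then show ?thesis by (simp add: algebra_simps)
    qed
    \<comment> \<open>The matrix acts on the complement of the all-ones vector as the scalar \<open>- N k\<close>.\<close>
    have act: "A *v v = (- ?N * k) *s v" if "v \<in> ?W" for v
    proof -
      have "(A *v v) $ i = - ?N * k * v $ i" for i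
      proof -
        have "(A *v v) $ i = (\<Sum>j\<in>UNIV. k * v $ j + (if j = i then - ?N * k * v $ i else 0))"
          unfolding matrix_vector_mult_def
          by (auto intro!: sum.cong simp: k diag algebra_simps)
        also have "\<dots> = - ?N * k * v $ i"
          using that by (simp add: sum.distrib sum_distrib_left[symmetric] mem_ones_comp)
        finally show ?thesis .
      qed
      then show ?thesis by (simp add: vec_eq_iff)
    qed
    have "eigenvalues_on ?W A = {- ?N * k}"
    proof (intro equalityI subsetI)
      fix \<mu> assume "\<mu> \<in> eigenvalues_on ?W A"
      then obtain v where "v \<in> ?W" "v \<noteq> 0" "A *v v = \<mu> *s v"
        by (auto simp: eigenvalues_on_def)
      then have "(- ?N * k) *s v = \<mu> *s v" "v \<noteq> 0" using act[of v] by simp_all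
      then show "\<mu> \<in> {- ?N * k}" by (simp only: vector_mul_rcancel) simp
    next
      fix \<mu> assume "\<mu> \<in> {- ?N * k}"
      then show "\<mu> \<in> eigenvalues_on ?W A"
        using act[OF centred_axis_mem] centred_axis_mem ne by (auto simp: eigenvalues_on_def)
    qed
    then have "\<gamma> = - ?N * k" by (simp add: \<gamma>_def)
    then show ?eq by (simp only: diag) (simp add: algebra_simps)
  qed
qed

section \<open>The frame matrix\<close>

lemma conjugate_of_real: "conjugate (of_real x :: 'f::rc_scalar) = of_real x"
proof (cases "x = 0")
  case False
  have "of_real x * conjugate (of_real x) = (of_real x * of_real x :: 'f)"
    by (simp add: mult_conjugate power2_eq_square)
  then show ?thesis using False by simp
qed simp

lemma re_part_of_real: "re_part (of_real x :: 'f::rc_scalar) = x"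
proof -
  have "(of_real (2 * x) :: 'f) = of_real (2 * re_part (of_real x :: 'f))"
    using add_conjugate_scaleR[of "of_real x :: 'f"]
    by (simp only: conjugate_of_real of_real_def[symmetric] of_real_add[symmetric] mult_2)
  then show ?thesis by (simp only: of_real_eq_iff mult_cancel_left) simp
qed

lemma norm_conjugate: "norm (conjugate x) = norm (x :: 'f::rc_scalar)"
proof -
  have "(of_real ((norm (conjugate x))\<^sup>2) :: 'f) = of_real ((norm x)\<^sup>2)"
    by (metis mult_conjugate conjugate_id mult.commute)
  then show ?thesis by (simp only: of_real_eq_iff) simp
qed

lemma norm_herm_inner_commute: "norm (herm_inner a b) = norm (herm_inner b a)"
  by (metis herm_inner_conjugate norm_conjugate)

lemma frame_gram_nth:
  fixes \<phi> :: "'n::finite \<Rightarrow> 'f::rc_scalar ^ 'd"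
  assumes "vec.subspace H" "unit_norm_tight_frame H \<phi>"
  shows "frame_gram H \<phi> $ i $ j
    = (norm (herm_inner (\<phi> i) (\<phi> j)))\<^sup>2 - 1 / real (vec.dim H)"
  by (simp only: frame_gram_def vec_lambda_beta trace_frame_Q[OF assms] re_part_of_real)

lemma unit_norm_tight_frame_dim_pos:
  assumes "unit_norm_tight_frame H \<phi>"
  shows "vec.dim H > 0"
proof -
  have "\<phi> undefined \<in> H" "norm (\<phi> undefined) = 1"
    using assms by (auto simp: unit_norm_tight_frame_def)
  then have "\<not> H \<subseteq> {0}" by auto
  then show ?thesis by (auto simp del: vec.dim_eq_0 simp: vec.dim_eq_0[symmetric])
qed

lemma
  fixes \<phi> :: "'n::finite \<Rightarrow> 'f::rc_scalar ^ 'd"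
  assumes H: "vec.subspace H" and \<phi>: "unit_norm_tight_frame H \<phi>"
  shows frame_gram_sym: "frame_gram H \<phi> $ i $ j = frame_gram H \<phi> $ j $ i"
    and frame_gram_diag: "frame_gram H \<phi> $ i $ i = 1 - 1 / real (vec.dim H)"
    and frame_gram_row_sum: "(\<Sum>j\<in>UNIV. frame_gram H \<phi> $ i $ j) = 0"
proof -
  show "frame_gram H \<phi> $ i $ j = frame_gram H \<phi> $ j $ i"
    by (simp add: frame_gram_nth[OF H \<phi>] norm_herm_inner_commute)
  have unit: "norm (\<phi> i) = 1" "\<phi> i \<in> H"
    using \<phi> by (auto simp: unit_norm_tight_frame_def)
  show "frame_gram H \<phi> $ i $ i = 1 - 1 / real (vec.dim H)"
    by (simp add: frame_gram_nth[OF H \<phi>] herm_inner_self unit)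
  have "(\<Sum>j\<in>UNIV. (norm (herm_inner (\<phi> i) (\<phi> j)))\<^sup>2) = real CARD('n) / real (vec.dim H)"
    using \<phi> unit by (auto simp: unit_norm_tight_frame_def)
  then show "(\<Sum>j\<in>UNIV. frame_gram H \<phi> $ i $ j) = 0"
    by (simp add: frame_gram_nth[OF H \<phi>] sum_subtractf)
qed

lemma equiangular_iff_frame_gram_off_diag:
  fixes \<phi> :: "'n::finite \<Rightarrow> 'f::rc_scalar ^ 'd"
  assumes H: "vec.subspace H" and \<phi>: "unit_norm_tight_frame H \<phi>"
  shows "equiangular_tight_frame H \<phi>
    \<longleftrightarrow> (\<exists>k. \<forall>i j. i \<noteq> j \<longrightarrow> frame_gram H \<phi> $ i $ j = k)"
proof
  assume "equiangular_tight_frame H \<phi>"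
  then show "\<exists>k. \<forall>i j. i \<noteq> j \<longrightarrow> frame_gram H \<phi> $ i $ j = k"
    by (auto simp: equiangular_tight_frame_def frame_gram_nth[OF H \<phi>])
next
  assume "\<exists>k. \<forall>i j. i \<noteq> j \<longrightarrow> frame_gram H \<phi> $ i $ j = k"
  then obtain k where k: "i \<noteq> j \<Longrightarrow> frame_gram H \<phi> $ i $ j = k" for i j by blast
  have "norm (herm_inner (\<phi> i) (\<phi> j)) = sqrt (k + 1 / real (vec.dim H))" if "i \<noteq> j" for i j
  proof -
    have "(norm (herm_inner (\<phi> i) (\<phi> j)))\<^sup>2 = k + 1 / real (vec.dim H)"
      using k[OF that] by (simp add: frame_gram_nth[OF H \<phi>])
    then show ?thesis by (metis norm_ge_zero real_sqrt_unique)
  qed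
  then show "equiangular_tight_frame H \<phi>"
    using \<phi> by (auto simp: equiangular_tight_frame_def)
qed

lemma frame_gamma_bound:
  fixes \<phi> :: "'n::finite \<Rightarrow> 'f::rc_scalar ^ 'd"
  assumes H: "vec.subspace H" and \<phi>: "unit_norm_tight_frame H \<phi>" and N: "CARD('n) \<ge> 2"
  defines "\<beta> \<equiv> real CARD('n) * (real (vec.dim H) - 1)
    / (real (vec.dim H) * (real CARD('n) - 1))"
  shows "frame_gamma H \<phi> \<le> \<beta>"
    and "frame_gamma H \<phi> = \<beta> \<longleftrightarrow> equiangular_tight_frame H \<phi>"
proof -
  let ?N = "real CARD('n)" and ?m = "real (vec.dim H)"
  have pos: "?m > 0" "?N > 1" using unit_norm_tight_frame_dim_pos[OF \<phi>] N by auto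
  note sym = frame_gram_sym[OF H \<phi>] and row = frame_gram_row_sum[OF H \<phi>]
  have \<beta>: "1 - 1 / ?m = \<beta> * (1 - 1 / ?N)" and pos': "1 - 1 / ?N > 0"
    using pos by (simp_all add: \<beta>_def divide_simps del: vec.dim_eq_0)
  show "frame_gamma H \<phi> \<le> \<beta>"
    using Min_eigenvalues_on_le_diag[OF sym row N, of undefined] pos'
    by (simp add: frame_gamma_def[symmetric] frame_gram_diag[OF H \<phi>] \<beta>)
  show "frame_gamma H \<phi> = \<beta> \<longleftrightarrow> equiangular_tight_frame H \<phi>"
    using Min_eigenvalues_on_eq_diag_iff[OF sym row N] pos'
    by (auto simp add: frame_gamma_def[symmetric] frame_gram_diag[OF H \<phi>] \<beta>
        equiangular_iff_frame_gram_off_diag[OF H \<phi>])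
qed

section \<open>The number of frame vectors\<close>

text \<open>The number \<open>\<bar>\<langle>\<phi>\<^sub>i, a\<rangle>\<bar>\<^sup>2\<close> is the value at \<open>a\<close> of the quadratic form of the projection \<open>P\<^sub>i\<close>, so
  the assumption on \<open>c\<close> says \<open>\<Sum>\<^sub>i c\<^sub>i P\<^sub>i = 0\<close>.\<close>

lemma frame_projections_independent:
  fixes \<phi> :: "'n::finite \<Rightarrow> 'f::rc_scalar ^ 'd"
  assumes H: "vec.subspace H" and \<phi>: "unit_norm_tight_frame H \<phi>" and N: "CARD('n) \<ge> 2"
    and \<gamma>: "frame_gamma H \<phi> > 0"
    and c: "\<And>a. (\<Sum>i\<in>UNIV. c $ i * (norm (herm_inner (\<phi> i) a))\<^sup>2) = 0"
  shows "c = 0"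
proof -
  let ?m = "real (vec.dim H)"
  have "?m > 0" using unit_norm_tight_frame_dim_pos[OF \<phi>] by simp
  note sym = frame_gram_sym[OF H \<phi>] and row = frame_gram_row_sum[OF H \<phi>]
  have unit: "norm (\<phi> i) = 1" "\<phi> i \<in> H" for i
    using \<phi> by (auto simp: unit_norm_tight_frame_def)
  have sum: "(\<Sum>j\<in>UNIV. (norm (herm_inner (\<phi> i) (\<phi> j)))\<^sup>2) = real CARD('n) / ?m" for i
    using \<phi> unit by (auto simp: unit_norm_tight_frame_def)
  \<comment> \<open>The rows of \<open>K\<close> sum to \<open>N/m\<close>, so summing \<open>K c = 0\<close> shows that \<open>c\<close> is orthogonal to \<open>1\<close>.\<close>
  have "0 = (\<Sum>j\<in>UNIV. \<Sum>i\<in>UNIV. c $ i * (norm (herm_inner (\<phi> i) (\<phi> j)))\<^sup>2)"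
    by (simp add: c)
  also have "\<dots> = (\<Sum>i\<in>UNIV. c $ i) * (real CARD('n) / ?m)"
    by (subst sum.swap) (simp only: sum sum_distrib_left[symmetric] sum_distrib_right)
  finally have c0: "(\<Sum>i\<in>UNIV. c $ i) = 0" using \<open>?m > 0\<close> by (auto simp del: vec.dim_eq_0)
  have "(frame_gram H \<phi> *v c) $ j = 0" for j
  proof -
    have "(frame_gram H \<phi> *v c) $ j
        = (\<Sum>i\<in>UNIV. c $ i * (norm (herm_inner (\<phi> i) (\<phi> j)))\<^sup>2 - 1 / ?m * c $ i)"
      unfolding matrix_vector_mult_def
      by (simp add: frame_gram_nth[OF H \<phi>] norm_herm_inner_commute[of "\<phi> j"] algebra_simps)
    also have "\<dots> = 0" by (simp add: sum_subtractf c c0 sum_divide_distrib[symmetric])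
    finally show ?thesis .
  qed
  then have "frame_gram H \<phi> *v c = 0" by (simp add: vec_eq_iff)
  then show ?thesis
    using Min_eigenvalues_on_kernel[OF sym row N _ _] \<gamma> c0
    by (simp add: frame_gamma_def mem_ones_comp)
qed

text \<open>Here \<open>x i p\<close> is the \<open>p\<close>-th coordinate of \<open>\<phi> i\<close> with respect to an arbitrary basis of \<open>H\<close>. The
  form \<open>\<Sum>\<^sub>i c\<^sub>i P\<^sub>i\<close> vanishes as soon as its coefficients do; the coefficients with \<open>p > q\<close> are
  conjugates of those with \<open>p \<le> q\<close>.\<close>

lemma frame_coordinates:
  fixes \<phi> :: "'n::finite \<Rightarrow> 'f::rc_scalar ^ 'd"
  assumes \<phi>: "\<And>i. \<phi> i \<in> H"
  obtains x :: "'n \<Rightarrow> nat \<Rightarrow> 'f" where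
    "\<And>c a. (\<And>p q. p \<le> q \<Longrightarrow> q < vec.dim H \<Longrightarrow>
        (\<Sum>i\<in>UNIV. of_real (c $ i) * (x i p * conjugate (x i q))) = 0) \<Longrightarrow>
      (\<Sum>i\<in>UNIV. c $ i * (norm (herm_inner (\<phi> i) a))\<^sup>2) = 0"
proof -
  let ?m = "vec.dim H"
  obtain B where "B \<subseteq> H" "vec.independent B" "H \<subseteq> vec.span B" and card: "card B = ?m"
    by (rule vec.basis_exists)
  then have B: "is_basis_of H B" by (simp add: is_basis_of_def)
  obtain e where e: "bij_betw e {..<?m} B"
    using ex_bij_betw_nat_finite[OF basis_finite[OF B]] by (auto simp: card atLeast0LessThan)
  define x where "x = (\<lambda>i p. vec.representation B (\<phi> i) (e p))"
  have x: "\<phi> i = (\<Sum>p<?m. x i p *s e p)" for i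
    using basis_expand[OF B \<phi>[of i]] sum.reindex_bij_betw[OF e, of "\<lambda>b. vec.representation B (\<phi> i) b *s b"]
    by (simp add: x_def)
  show ?thesis
  proof (rule that[of x])
    fix c :: "real ^ 'n" and a :: "'f ^ 'd"
    assume "\<And>p q. p \<le> q \<Longrightarrow> q < ?m \<Longrightarrow>
      (\<Sum>i\<in>UNIV. of_real (c $ i) * (x i p * conjugate (x i q))) = 0"
    note * = this
    have zero: "(\<Sum>i\<in>UNIV. of_real (c $ i) * (x i p * conjugate (x i q))) = 0"
      if pq: "p < ?m" "q < ?m" for p q
    proof (cases "p \<le> q")
      case True
      then show ?thesis using * pq by simp
    next
      case False
      then have "conjugate (\<Sum>i\<in>UNIV. of_real (c $ i) * (x i q * conjugate (x i p))) = 0"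
        using * pq by simp
      then show ?thesis
        by (simp add: sum_conjugate conjugate_dist_mul conjugate_of_real mult_ac)
    qed
    define h where "h = (\<lambda>p. herm_inner (e p) a)"
    have inner: "herm_inner (\<phi> i) a = (\<Sum>p<?m. x i p * h p)" for i
    proof -
      have "herm_inner (\<phi> i) a = (\<Sum>k\<in>UNIV. \<Sum>p<?m. x i p * (e p $ k * conjugate (a $ k)))"
        unfolding herm_inner_def
        by (subst x) (simp add: sum_distrib_right mult.assoc)
      also have "\<dots> = (\<Sum>p<?m. x i p * h p)"
        unfolding h_def herm_inner_def sum_distrib_left by (rule sum.swap)
      finally show ?thesis .
    qed
    have "of_real ((norm (herm_inner (\<phi> i) a))\<^sup>2)
        = (\<Sum>p<?m. \<Sum>q<?m. h p * conjugate (h q) * (x i p * conjugate (x i q)))" for i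
      unfolding mult_conjugate[symmetric] inner
      by (simp add: sum_conjugate conjugate_dist_mul sum_product) (simp only: mult_ac)
    then have "of_real (\<Sum>i\<in>UNIV. c $ i * (norm (herm_inner (\<phi> i) a))\<^sup>2)
        = (\<Sum>i\<in>UNIV. \<Sum>p<?m. \<Sum>q<?m.
            h p * conjugate (h q) * (of_real (c $ i) * (x i p * conjugate (x i q))))"
      by (simp only: of_real_sum of_real_mult sum_distrib_left mult.left_commute)
    also have "\<dots> = (\<Sum>p<?m. \<Sum>q<?m. \<Sum>i\<in>UNIV.
            h p * conjugate (h q) * (of_real (c $ i) * (x i p * conjugate (x i q))))"
      by (simp only: sum.swap[of _ _ UNIV])
    also have "\<dots> = 0"
      by (simp only: sum_distrib_left[symmetric]) (simp add: zero)
    finally show "(\<Sum>i\<in>UNIV. c $ i * (norm (herm_inner (\<phi> i) a))\<^sup>2) = 0"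
      by (simp only: of_real_eq_0_iff)
  qed
qed

lemma CARD_le_card_if_no_common_orthogonal:
  fixes S :: "(real ^ 'n) set"
  assumes "finite S" and "\<And>c. (\<And>s. s \<in> S \<Longrightarrow> s \<bullet> c = 0) \<Longrightarrow> c = 0"
  shows "CARD('n) \<le> card S"
proof -
  have "span S = UNIV"
  proof (rule ccontr)
    assume "span S \<noteq> UNIV"
    then obtain c where "c \<noteq> 0" "span S \<subseteq> {x. c \<bullet> x = 0}"
      using span_not_univ_subset_hyperplane by blast
    then have "s \<bullet> c = 0" if "s \<in> S" for s
      using that span_base[of s S] by (auto simp: inner_commute)
    then show False using assms(2) \<open>c \<noteq> 0\<close> by blast
  qed
  then have "dim S = CARD('n)" by (metis dim_span dim_UNIV DIM_cart DIM_real mult_1_right)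
  then show ?thesis using dim_le_card'[OF assms(1)] by simp
qed

lemma card_real_frame_le:
  fixes \<phi> :: "'n::finite \<Rightarrow> real ^ 'd"
  assumes H: "vec.subspace H" and \<phi>: "unit_norm_tight_frame H \<phi>" and N: "CARD('n) \<ge> 2"
    and \<gamma>: "frame_gamma H \<phi> > 0"
  shows "real CARD('n) \<le> real (vec.dim H) * (real (vec.dim H) + 1) / 2"
proof -
  let ?m = "vec.dim H"
  obtain x :: "'n \<Rightarrow> nat \<Rightarrow> real" where x:
    "\<And>c a. (\<And>p q. p \<le> q \<Longrightarrow> q < ?m \<Longrightarrow>
        (\<Sum>i\<in>UNIV. of_real (c $ i) * (x i p * conjugate (x i q))) = 0) \<Longrightarrow>
      (\<Sum>i\<in>UNIV. c $ i * (norm (herm_inner (\<phi> i) a))\<^sup>2) = 0"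
    by (rule frame_coordinates[of \<phi> H]) (use \<phi> in \<open>auto simp: unit_norm_tight_frame_def\<close>)
  define I where "I = (SIGMA q:{..<?m}. {..q})"
  define u where "u = (\<lambda>(q, p). \<chi> i. x i p * x i q)"
  have "CARD('n) \<le> card (u ` I)"
  proof (rule CARD_le_card_if_no_common_orthogonal)
    fix c assume c: "\<And>s. s \<in> u ` I \<Longrightarrow> s \<bullet> c = 0"
    have "u (q, p) \<bullet> c = 0" if "p \<le> q" "q < ?m" for p q
      using that by (intro c) (auto simp: I_def)
    then show "c = 0"
      by (intro frame_projections_independent[OF H \<phi> N \<gamma>] x)
        (simp add: u_def inner_vec_def mult_ac)
  qed (simp add: I_def)
  also have "\<dots> \<le> card I" by (intro card_image_le) (simp add: I_def)
  also have "card I = (\<Sum>q<?m. Suc q)" by (simp add: I_def)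
  finally have "real CARD('n) \<le> real (\<Sum>q<?m. Suc q)" by (simp only: of_nat_le_iff)
  also have "real (\<Sum>q<k. Suc q) = real k * (real k + 1) / 2" for k
    by (induction k) (simp_all add: field_simps)
  finally show ?thesis .
qed

lemma card_complex_frame_le:
  fixes \<phi> :: "'n::finite \<Rightarrow> complex ^ 'd"
  assumes H: "vec.subspace H" and \<phi>: "unit_norm_tight_frame H \<phi>" and N: "CARD('n) \<ge> 2"
    and \<gamma>: "frame_gamma H \<phi> > 0"
  shows "real CARD('n) \<le> (real (vec.dim H))\<^sup>2"
proof -
  let ?m = "vec.dim H"
  obtain x :: "'n \<Rightarrow> nat \<Rightarrow> complex" where x:
    "\<And>c a. (\<And>p q. p \<le> q \<Longrightarrow> q < ?m \<Longrightarrow>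
        (\<Sum>i\<in>UNIV. of_real (c $ i) * (x i p * conjugate (x i q))) = 0) \<Longrightarrow>
      (\<Sum>i\<in>UNIV. c $ i * (norm (herm_inner (\<phi> i) a))\<^sup>2) = 0"
    by (rule frame_coordinates[of \<phi> H]) (use \<phi> in \<open>auto simp: unit_norm_tight_frame_def\<close>)
  \<comment> \<open>The equation for \<open>p < q\<close> splits into two real ones: the real part is stored under \<open>(p, q)\<close> and
    the imaginary part under \<open>(q, p)\<close>. For \<open>p = q\<close> the imaginary part is zero.\<close>
  define I where "I = {..<?m} \<times> {..<?m}"
  define z where "z = (\<lambda>i p q. x i p * cnj (x i q))"
  define u where "u = (\<lambda>(p, q). \<chi> i. if p \<le> q then Re (z i p q) else Im (z i q p))"
  have "CARD('n) \<le> card (u ` I)"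
  proof (rule CARD_le_card_if_no_common_orthogonal)
    fix c assume c: "\<And>s. s \<in> u ` I \<Longrightarrow> s \<bullet> c = 0"
    have "(\<Sum>i\<in>UNIV. of_real (c $ i) * z i p q) = 0" if pq: "p \<le> q" "q < ?m" for p q
    proof -
      have "u (p, q) \<bullet> c = 0" using pq by (intro c) (auto simp: I_def)
      then have "(\<Sum>i\<in>UNIV. c $ i * Re (z i p q)) = 0"
        using pq by (simp add: u_def inner_vec_def mult_ac)
      moreover have "(\<Sum>i\<in>UNIV. c $ i * Im (z i p q)) = 0"
      proof (cases "p = q")
        case True
        then show ?thesis by (simp add: z_def)
      next
        case False
        have "u (q, p) \<bullet> c = 0" using pq by (intro c) (auto simp: I_def)
        then show ?thesis using pq False by (simp add: u_def inner_vec_def mult_ac)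
      qed
      ultimately show ?thesis by (simp add: complex_eq_iff)
    qed
    then show "c = 0"
      by (intro frame_projections_independent[OF H \<phi> N \<gamma>] x) (simp add: z_def)
  qed (simp add: I_def)
  also have "\<dots> \<le> card I" by (intro card_image_le) (simp add: I_def)
  also have "card I = ?m\<^sup>2" by (simp add: I_def power2_eq_square)
  finally show ?thesis by (simp only: of_nat_le_iff flip: of_nat_power)
qed

theorem theorem3p3:
  shows
    "(\<forall>(H :: (real ^ 'M::finite) set) (\<phi> :: 'N::finite \<Rightarrow> real ^ 'M) m N.
        vec.subspace H \<and> vec.dim H = m \<and> CARD('N) = N \<and> N \<ge> 2 \<and>
        unit_norm_tight_frame H \<phi> \<and> frame_gamma H \<phi> > 0 \<longrightarrow>
          real N \<le> real m * (real m + 1) / 2 \<and>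
          frame_gamma H \<phi> \<le> real N * (real m - 1) / (real m * (real N - 1)) \<and>
          (frame_gamma H \<phi> = real N * (real m - 1) / (real m * (real N - 1)) \<longleftrightarrow>
             equiangular_tight_frame H \<phi>)) \<and>
     (\<forall>(H :: (complex ^ 'M) set) (\<phi> :: 'N \<Rightarrow> complex ^ 'M) m N.
        vec.subspace H \<and> vec.dim H = m \<and> CARD('N) = N \<and> N \<ge> 2 \<and>
        unit_norm_tight_frame H \<phi> \<and> frame_gamma H \<phi> > 0 \<longrightarrow>
          real N \<le> (real m)\<^sup>2 \<and>
          frame_gamma H \<phi> \<le> real N * (real m - 1) / (real m * (real N - 1)) \<and>
          (frame_gamma H \<phi> = real N * (real m - 1) / (real m * (real N - 1)) \<longleftrightarrow>
             equiangular_tight_frame H \<phi>))"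
  by (intro conjI allI impI; elim conjE; hypsubst;
      intro frame_gamma_bound card_real_frame_le card_complex_frame_le; assumption)

end
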